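(* Let $(X,d)$ be a metric space, $Y$ a real vector space, $K\subset Y$ a convex cone, $H\subset K$ a nonempty $K$-convex set with $0\notin \mathrm{vcl}(H+K)$, $f:X\to 2^Y$ a set-valued map, $x_0\in X$, $\epsilon>0$ and $\lambda>0$. For any $x\in X$, put $$S(x):=\Big\{x'\in X:\ f(x)\subset f(x')+\frac{\epsilon}{\lambda}d(x,x')H+K\Big\}.$$ Suppose that the following conditions are satisfied: (i) $(X,d)$ is $S(x_0)$-dynamically complete; (ii) $f(x_0)\not\subset f(S(x_0))+\epsilon H+K$; (iii) $f$ is $K$-slm and has $K_H$-$v_0$-closed values, where $v_0\in K+H$. Then there exists $\bar x\in X$ such that (a) $f(x_0)\subset f(\bar x)+(\epsilon/\lambda)d(x_0,\bar x)H+K$; (b) $f(\bar x)\not\subset f(x)+(\epsilon/\lambda)d(\bar x,x)H+K$ for all $x\in X\setminus\{\bar x\}$; (c) $d(x_0,\bar x)\le\lambda$.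
   Context: $2^Y$ is the family of all subsets of $Y$; for $A\subset X$, $f(A)=\bigcup_{x\in A}f(x)$. For $A,B\subset Y$ and $\alpha\in\mathbb R$, $A+B=\{a+b:a\in A,b\in B\}$ and $\alpha A=\{\alpha a:a\in A\}$. A cone is a nonempty set $K\subset Y$ with $\alpha K\subset K$ for all $\alpha\ge 0$; it is a convex cone if also $K+K\subset K$. Cones are always assumed nontrivial: $K\ne\{0\}$ and $K\ne Y$. A set $H$ is $K$-convex if $H+K$ is convex. For nonempty $A\subset Y$, the vector closure is $\mathrm{vcl}(A)=\{y\in Y:\exists v\in Y,\ \exists \lambda_n\ge 0,\ \lambda_n\to 0 \text{ with } y+\lambda_n v\in A\ \forall n\in\mathbb N\}$; for $v_0\in Y$, $\mathrm{vcl}_{v_0}(A)=\{y\in Y:\exists\lambda_n\ge 0,\ \lambda_n\to 0\text{ with }y+\lambda_n v_0\in A\ \forall n\in\mathbb N\}$, and $A$ is $v_0$-closed if $A=\mathrm{vcl}_{v_0}(A)$. $(X,d)$ is $S(x)$-dynamically complete if for any Cauchy sequence $(x_n)\subset S(x)$ with $x_{n+1}\in S(x_n)$ for all $n$, there exists $\bar x\in X$ with $x_n\to\bar x$. $f$ is $K$-slm ($K$-sequentially lower monotone) if for any sequence $(x_n)\subset X$ with $x_n\to\bar x\in X$ and $f(x_n)\subset f(x_{n+1})+K$ for all $n$, one has $f(x_n)\subset f(\bar x)+K$ for all $n$. $f$ has $K_H$-$v_0$-closed values if for any $x\in X$ and any $\alpha>0$, $f(x)+\alpha H+K$ is $v_0$-closed.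 *)

theory Defs
  imports "HOL-Analysis.Analysis"
begin

text \<open>
  Set addition \<open>A + B\<close> is the Minkowski sum of \<open>HOL-Library.Set_Algebras\<close>, and the dilation
  \<open>\<alpha>A\<close> is written as the image \<open>(*\<^sub>R) \<alpha> ` A\<close>; in particular \<open>0H = {0}\<close> for nonempty \<open>H\<close>.
  Set-valued maps \<open>f : X \<rightarrow> 2\<^sup>Y\<close> may take the value \<open>{}\<close>.
\<close>

text \<open>The library predicate \<open>cone\<close> admits the empty set, hence the separate nonemptiness.\<close>

definition nontrivial_convex_cone :: "'b::real_vector set \<Rightarrow> bool" where
  "nontrivial_convex_cone K \<longleftrightarrow>
     K \<noteq> {} \<and> cone K \<and> K + K \<subseteq> K \<and> K \<noteq> {0} \<and> K \<noteq> UNIV"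

definition K_convex :: "'b::real_vector set \<Rightarrow> 'b set \<Rightarrow> bool" where
  "K_convex K H \<longleftrightarrow> convex (H + K)"

definition vcl_dir :: "'b::real_vector \<Rightarrow> 'b set \<Rightarrow> 'b set" where
  "vcl_dir v A =
     {y. \<exists>l::nat \<Rightarrow> real. (\<forall>n. 0 \<le> l n) \<and> l \<longlonglongrightarrow> 0 \<and> (\<forall>n. y + l n *\<^sub>R v \<in> A)}"

definition vcl :: "'b::real_vector set \<Rightarrow> 'b set" where
  "vcl A =
     {y. \<exists>v. \<exists>l::nat \<Rightarrow> real. (\<forall>n. 0 \<le> l n) \<and> l \<longlonglongrightarrow> 0 \<and> (\<forall>n. y + l n *\<^sub>R v \<in> A)}"

text \<open>The empty set counts as \<open>v\<close>-closed, since \<open>vcl_dir v {} = {}\<close>.\<close>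

definition dir_closed :: "'b::real_vector \<Rightarrow> 'b set \<Rightarrow> bool" where
  "dir_closed v A \<longleftrightarrow> A = vcl_dir v A"

text \<open>\<open>dynamically_complete S x\<close>: the space is \<open>S(x)\<close>-dynamically complete.\<close>

definition dynamically_complete :: "('a::metric_space \<Rightarrow> 'a set) \<Rightarrow> 'a \<Rightarrow> bool" where
  "dynamically_complete S x \<longleftrightarrow>
     (\<forall>u::nat \<Rightarrow> 'a. Cauchy u \<and> (\<forall>n. u n \<in> S x) \<and> (\<forall>n. u (Suc n) \<in> S (u n))
        \<longrightarrow> (\<exists>xbar. u \<longlonglongrightarrow> xbar))"

text \<open>\<open>K\<close>-sequential lower monotonicity.\<close>

definition K_slm :: "'b::real_vector set \<Rightarrow> ('a::metric_space \<Rightarrow> 'b set) \<Rightarrow> bool" where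
  "K_slm K f \<longleftrightarrow>
     (\<forall>(u::nat \<Rightarrow> 'a) xbar. u \<longlonglongrightarrow> xbar \<and> (\<forall>n. f (u n) \<subseteq> f (u (Suc n)) + K)
        \<longrightarrow> (\<forall>n. f (u n) \<subseteq> f xbar + K))"

definition KH_dir_closed_values ::
    "'b::real_vector set \<Rightarrow> 'b set \<Rightarrow> 'b \<Rightarrow> ('a \<Rightarrow> 'b set) \<Rightarrow> bool" where
  "KH_dir_closed_values K H v f \<longleftrightarrow>
     (\<forall>x. \<forall>\<alpha>>0. dir_closed v (f x + (*\<^sub>R) \<alpha> ` H + K))"

text \<open>\<open>S_set K H f c x\<close> is the set \<open>S(x)\<close>, with \<open>c\<close> in the role of \<open>\<epsilon>/\<lambda>\<close>.\<close>

definition S_set ::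
    "'b::real_vector set \<Rightarrow> 'b set \<Rightarrow> ('a::metric_space \<Rightarrow> 'b set) \<Rightarrow> real \<Rightarrow> 'a \<Rightarrow> 'a set" where
  "S_set K H f c x = {x'. f x \<subseteq> f x' + (*\<^sub>R) (c * dist x x') ` H + K}"

end

theory Submission
  imports Defs
begin

text \<open>
  The relation \<open>x' \<in> S(x)\<close> is a preorder: convexity of \<open>H + K\<close> gives
  \<open>sH + tH + K \<subseteq> (s + t)H + K\<close>, and \<open>H \<subseteq> K\<close> lets a multiple of \<open>H\<close> shrink, so the triangle
  inequality yields transitivity (\<open>S_set_trans\<close>). The conclusion asks for a point \<open>xbar\<close> that is
  maximal for this preorder and lies above \<open>x0\<close>.

  The noninclusion hypothesis supplies a point \<open>y0\<close> of \<open>f x0\<close> that no \<open>x \<in> S(x0)\<close> can reach with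
  weight \<open>\<epsilon>\<close>. Along a chain starting at \<open>x0\<close>, the weights used to reach \<open>y0\<close> add up to
  \<open>\<epsilon>/\<lambda>\<close> times the length of the chain; hence every finite chain is shorter than \<open>\<lambda>\<close>. Infinite chains are
  therefore Cauchy, and already \<open>S(x0)\<close> lies in the ball of radius \<open>\<lambda>\<close>. Dynamic completeness gives
  each chain a limit, and that limit is an upper bound of the chain (\<open>chain_limit_in_S_set\<close>):
  sequential lower monotonicity replaces the values along the chain by the value at the limit,
  and the weights converge to the required one, because a missing amount of weight can be added
  in the direction \<open>v0\<close> and then removed by \<open>v0\<close>-closedness. A greedy choice of long jumps
  (\<open>maximal_point_of_preorder\<close>) turns these facts into the maximal point.
\<close>

section \<open>A maximal point for a preorder on a metric space\<close>

lemma bounded_almost_farthest_point: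
  fixes A :: "'a::metric_space set"
  assumes "bounded A" "x \<in> A"
  shows "\<exists>x'\<in>A. \<forall>z\<in>A. dist x z \<le> 2 * dist x x'"
proof -
  let ?D = "SUP z\<in>A. dist x z"
  obtain e where "\<forall>z\<in>A. dist x z \<le> e"
    using assms(1) bounded_any_center by blast
  then have bdd: "bdd_above (dist x ` A)"
    by (auto simp: bdd_above_def)
  have up: "dist x z \<le> ?D" if "z \<in> A" for z
    using cSUP_upper[OF that bdd] .
  show ?thesis
  proof (cases "?D \<le> 0")
    case True
    then have "dist x z \<le> 2 * dist x x" if "z \<in> A" for z
      using order_trans[OF up[OF that] True] by simp
    then show ?thesis using assms(2) by blast
  next
    case False
    then have "?D / 2 < ?D" by simp
    then obtain x' where "x' \<in> A" "?D / 2 < dist x x'"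
      using less_cSUP_iff[of A "dist x" "?D / 2"] assms(2) bdd by auto
    then show ?thesis using up by force
  qed
qed

text \<open>
  From each point of the chain jump at least half as far as possible. Convergence of the chain
  forces the jumps to tend to \<open>0\<close>, so the sets \<open>S (u n)\<close> shrink to the limit; anything
  above the limit lies in all of them and is thus the limit itself.
\<close>

lemma maximal_point_of_preorder:
  fixes S :: "'a::metric_space \<Rightarrow> 'a set"
  assumes refl: "\<And>x. x \<in> S x"
    and trans: "\<And>x y z. y \<in> S x \<Longrightarrow> z \<in> S y \<Longrightarrow> z \<in> S x"
    and bdd: "bounded (S x0)"
    and limit: "\<And>u. u 0 = x0 \<Longrightarrow> (\<And>n. u (Suc n) \<in> S (u n)) \<Longrightarrow>
        \<exists>xbar. u \<longlonglongrightarrow> xbar \<and> (\<forall>n. xbar \<in> S (u n))"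
  shows "\<exists>xbar\<in>S x0. S xbar \<subseteq> {xbar}"
proof -
  have "\<forall>x\<in>S x0. \<exists>x'. x' \<in> S x \<and> (\<forall>z\<in>S x. dist x z \<le> 2 * dist x x')"
  proof
    fix x assume "x \<in> S x0"
    then have "S x \<subseteq> S x0" using trans by blast
    then have "bounded (S x)" using bdd bounded_subset by blast
    then show "\<exists>x'. x' \<in> S x \<and> (\<forall>z\<in>S x. dist x z \<le> 2 * dist x x')"
      using bounded_almost_farthest_point refl by blast
  qed
  then obtain g where g: "\<And>x. x \<in> S x0 \<Longrightarrow> g x \<in> S x"
    and far: "\<And>x z. x \<in> S x0 \<Longrightarrow> z \<in> S x \<Longrightarrow> dist x z \<le> 2 * dist x (g x)"
    by metis
  define u where "u n = (g ^^ n) x0" for n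
  have u_Suc: "u (Suc n) = g (u n)" for n by (simp add: u_def)
  have u_in: "u n \<in> S x0" for n
    by (induction n) (use refl g trans u_def in \<open>auto simp: u_Suc\<close>)
  obtain xbar where lim: "u \<longlonglongrightarrow> xbar" and ub: "\<And>n. xbar \<in> S (u n)"
    using limit[of u] g u_in by (metis u_Suc u_def funpow_0)
  have "z = xbar" if "z \<in> S xbar" for z
  proof -
    have "dist (u n) z \<le> 2 * dist (u n) (u (Suc n))" for n
      using far u_in trans[OF ub that] u_Suc by metis
    moreover have "(\<lambda>n. 2 * dist (u n) (u (Suc n))) \<longlonglongrightarrow> 2 * dist xbar xbar"
      by (intro tendsto_intros lim LIMSEQ_Suc)
    moreover have "(\<lambda>n. dist (u n) z) \<longlonglongrightarrow> dist xbar z"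
      by (intro tendsto_intros lim)
    ultimately have "dist xbar z \<le> 2 * dist xbar xbar"
      using LIMSEQ_le by blast
    then show ?thesis by simp
  qed
  then show ?thesis using ub[of 0] by (auto simp: u_def)
qed

section \<open>The preorder defined by a convex perturbation of a cone\<close>

locale cone_perturbation =
  fixes K H :: "'b::real_vector set"
  assumes cone_K: "cone K" and add_K: "K + K \<subseteq> K" and K_nonempty: "K \<noteq> {}"
    and H_nonempty: "H \<noteq> {}" and H_subset: "H \<subseteq> K" and convex_HK: "convex (H + K)"
begin

abbreviation shift :: "real \<Rightarrow> 'b set" where
  "shift t \<equiv> (*\<^sub>R) t ` H + K"

lemma zero_in_K: "0 \<in> K"
  using cone_K K_nonempty cone_contains_0 by blast

lemma scale_K: "0 \<le> t \<Longrightarrow> k \<in> K \<Longrightarrow> t *\<^sub>R k \<in> K"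
  using cone_K by (auto simp: cone_def)

lemma K_add_closed: "a \<in> K \<Longrightarrow> b \<in> K \<Longrightarrow> a + b \<in> K"
  using add_K by (auto simp: set_plus_def)

lemma shiftI: "h \<in> H \<Longrightarrow> k \<in> K \<Longrightarrow> t *\<^sub>R h + k \<in> shift t"
  by (auto simp: set_plus_def)

lemma shiftE:
  assumes "y \<in> shift t"
  obtains h k where "h \<in> H" "k \<in> K" "y = t *\<^sub>R h + k"
  using assms by (auto simp: set_plus_def)

lemma shift_zero: "shift 0 = K"
  using H_nonempty by (simp add: image_constant_conv)

lemma shift_antimono:
  assumes "s \<le> t"
  shows "shift t \<subseteq> shift s"
proof
  fix y assume "y \<in> shift t"
  then obtain h k where hk: "h \<in> H" "k \<in> K" "y = t *\<^sub>R h + k" by (rule shiftE)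
  have "y = s *\<^sub>R h + ((t - s) *\<^sub>R h + k)"
    using hk(3) by (simp add: algebra_simps)
  then show "y \<in> shift s"
    using hk H_subset assms shiftI K_add_closed scale_K by (metis diff_ge_0_iff_ge subsetD)
qed

lemma scaled_HK_in_shift:
  assumes "0 \<le> t" "w \<in> H + K"
  shows "t *\<^sub>R w \<in> shift t"
proof -
  obtain h k where hk: "h \<in> H" "k \<in> K" "w = h + k"
    using assms(2) by (auto simp: set_plus_def)
  then show ?thesis
    using assms(1) by (auto simp: scaleR_add_right intro!: shiftI scale_K)
qed

text \<open>
  Up to the factor \<open>s + t\<close>, the sum \<open>s *\<^sub>R h + t *\<^sub>R h'\<close> is a convex combination of two points of
  \<open>H + K\<close>; this is the only way in which convexity of \<open>H + K\<close> enters.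
\<close>

lemma shift_add:
  assumes "0 \<le> s" "0 \<le> t"
  shows "shift s + shift t \<subseteq> shift (s + t)"
proof
  fix y assume "y \<in> shift s + shift t"
  then obtain a b where ab: "a \<in> shift s" "b \<in> shift t" "y = a + b"
    by (auto simp: set_plus_def)
  obtain h k where hk: "h \<in> H" "k \<in> K" "a = s *\<^sub>R h + k" using ab(1) by (rule shiftE)
  obtain h' k' where hk': "h' \<in> H" "k' \<in> K" "b = t *\<^sub>R h' + k'" using ab(2) by (rule shiftE)
  have in_HK: "h \<in> H + K" "h' \<in> H + K"
    using hk(1) hk'(1) set_zero_plus2[OF zero_in_K, of H] by (auto simp: add.commute)
  have "s *\<^sub>R h + t *\<^sub>R h' \<in> shift (s + t)"
  proof (cases "s + t = 0")
    case True
    then have "s = 0" "t = 0" using assms by auto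
    then show ?thesis using zero_in_K shift_zero by simp
  next
    case False
    then have pos: "0 < s + t" using assms by linarith
    define w where "w = (s / (s + t)) *\<^sub>R h + (t / (s + t)) *\<^sub>R h'"
    have "w \<in> H + K"
      unfolding w_def using in_HK assms pos
      by (intro convexD[OF convex_HK]) (auto simp: add_divide_distrib[symmetric])
    then have "(s + t) *\<^sub>R w \<in> shift (s + t)"
      using scaled_HK_in_shift pos by simp
    moreover have "(s + t) *\<^sub>R w = s *\<^sub>R h + t *\<^sub>R h'"
      using pos by (simp add: w_def scaleR_add_right)
    ultimately show ?thesis by simp
  qed
  then obtain h'' k'' where e: "h'' \<in> H" "k'' \<in> K" "s *\<^sub>R h + t *\<^sub>R h' = (s + t) *\<^sub>R h'' + k''"
    by (rule shiftE)
  have "y = (s *\<^sub>R h + t *\<^sub>R h') + (k + k')"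
    using ab(3) hk(3) hk'(3) by (simp add: algebra_simps)
  also have "\<dots> = (s + t) *\<^sub>R h'' + (k'' + (k + k'))"
    using e(3) by (simp add: algebra_simps)
  finally show "y \<in> shift (s + t)"
    using shiftI e hk(2) hk'(2) K_add_closed by metis
qed

lemma shift_chain:
  assumes "A \<subseteq> B + shift s" "B \<subseteq> C + shift t" "0 \<le> s" "0 \<le> t"
  shows "A \<subseteq> C + shift (s + t)"
proof -
  have "A \<subseteq> (C + shift t) + shift s"
    using assms(1) set_plus_mono2[OF assms(2) order_refl] by blast
  also have "\<dots> = C + (shift s + shift t)" by (simp only: add.commute[of "shift s"] add.assoc[of C])
  also have "\<dots> \<subseteq> C + shift (s + t)"
    using set_plus_mono2[OF order_refl shift_add[OF assms(3,4)]] .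
  finally show ?thesis .
qed

lemma S_set_iff: "x' \<in> S_set K H f c x \<longleftrightarrow> f x \<subseteq> f x' + shift (c * dist x x')"
  by (simp add: S_set_def add.assoc)

lemma S_set_refl: "x \<in> S_set K H f c x"
  unfolding S_set_iff dist_self mult_zero_right shift_zero
  using set_zero_plus2[OF zero_in_K, of "f x"] by (simp add: add.commute)

lemma S_set_trans:
  assumes "0 \<le> c" "y \<in> S_set K H f c x" "z \<in> S_set K H f c y"
  shows "z \<in> S_set K H f c x"
proof -
  have "f x \<subseteq> f z + shift (c * dist x y + c * dist y z)"
    using assms by (intro shift_chain[of "f x" "f y"]) (auto simp: S_set_iff)
  moreover have "c * dist x z \<le> c * dist x y + c * dist y z"
    using assms(1) mult_left_mono[OF dist_triangle] by (simp add: distrib_left[symmetric])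
  ultimately show ?thesis
    unfolding S_set_iff using set_plus_mono2[OF order_refl shift_antimono] by blast
qed

lemma S_set_chain_mono:
  assumes "0 \<le> c" "\<And>n. u (Suc n) \<in> S_set K H f c (u n)" "n \<le> m"
  shows "u m \<in> S_set K H f c (u n)"
  using assms(3)
proof (induction m rule: dec_induct)
  case base
  show ?case by (rule S_set_refl)
next
  case (step m)
  show ?case using S_set_trans[OF assms(1) step.IH assms(2)] .
qed

section \<open>Limits of chains\<close>

text \<open>
  A weight \<open>a n\<close> below the limit weight \<open>\<alpha>\<close> is raised to \<open>\<alpha>\<close> by adding
  \<open>(\<alpha> - a n) *\<^sub>R v\<close>; this displacement tends to \<open>0\<close>, so closedness in the direction \<open>v\<close>
  absorbs it. If some weight is at least \<open>\<alpha>\<close>, monotonicity in the weight suffices.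
\<close>

lemma shift_limit:
  assumes closed: "dir_closed v (A + shift \<alpha>)" and v: "v \<in> H + K"
    and lim: "a \<longlonglongrightarrow> \<alpha>" and nonneg: "\<And>n. 0 \<le> a n"
    and y: "\<And>n. y \<in> A + shift (a n)"
  shows "y \<in> A + shift \<alpha>"
proof (cases "\<exists>n. \<alpha> \<le> a n")
  case True
  then show ?thesis
    using y set_plus_mono2[OF order_refl shift_antimono] by blast
next
  case False
  then have less: "a n \<le> \<alpha>" for n by (meson linear)
  have mem: "y + (\<alpha> - a n) *\<^sub>R v \<in> A + shift \<alpha>" for n
  proof -
    have "(\<alpha> - a n) *\<^sub>R v \<in> shift (\<alpha> - a n)"
      using scaled_HK_in_shift v less by simp
    then have "y + (\<alpha> - a n) *\<^sub>R v \<in> A + shift (a n) + shift (\<alpha> - a n)"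
      using y set_plus_intro by blast
    also have "\<dots> \<subseteq> A + shift (a n + (\<alpha> - a n))"
      unfolding add.assoc[of A]
      using set_plus_mono2[OF order_refl shift_add[of "a n" "\<alpha> - a n"]] nonneg less by simp
    finally show ?thesis by simp
  qed
  have "(\<lambda>n. \<alpha> - a n) \<longlonglongrightarrow> \<alpha> - \<alpha>" by (intro tendsto_intros lim)
  then have "y \<in> vcl_dir v (A + shift \<alpha>)"
    unfolding vcl_dir_def using mem less by (auto intro!: exI[of _ "\<lambda>n. \<alpha> - a n"])
  then show ?thesis using closed by (simp add: dir_closed_def)
qed

lemma chain_limit_in_S_set:
  assumes c: "0 < c" and slm: "K_slm K f"
    and closed: "KH_dir_closed_values K H v f" and v: "v \<in> H + K"
    and chain: "\<And>n. u (Suc n) \<in> S_set K H f c (u n)" and lim: "u \<longlonglongrightarrow> xbar"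
  shows "xbar \<in> S_set K H f c (u n)"
proof -
  have "f (u m) \<subseteq> f (u (Suc m)) + K" for m
  proof -
    have "shift (c * dist (u m) (u (Suc m))) \<subseteq> K"
      using shift_antimono[of 0] shift_zero c by simp
    then show ?thesis
      using chain[of m] set_plus_mono2[OF order_refl] unfolding S_set_iff by blast
  qed
  then have below: "f (u m) \<subseteq> f xbar + shift 0" for m
    using slm lim unfolding K_slm_def shift_zero by blast
  have weights: "f (u n) \<subseteq> f xbar + shift (c * dist (u n) (u (m + n)))" for m
  proof -
    have "u (m + n) \<in> S_set K H f c (u n)"
      using S_set_chain_mono[of c u f] chain c by simp
    from shift_chain[OF this[unfolded S_set_iff] below] show ?thesis using c by simp
  qed
  show ?thesis
  proof (cases "u n = xbar")
    case True
    then show ?thesis using S_set_refl by simp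
  next
    case False
    let ?\<alpha> = "c * dist (u n) xbar"
    have closed_value: "dir_closed v (f xbar + shift ?\<alpha>)"
      using closed False c unfolding KH_dir_closed_values_def by (simp add: add.assoc)
    have lim_weights: "(\<lambda>m. c * dist (u n) (u (m + n))) \<longlonglongrightarrow> ?\<alpha>"
      by (intro tendsto_intros LIMSEQ_ignore_initial_segment lim)
    have "y \<in> f xbar + shift ?\<alpha>" if "y \<in> f (u n)" for y
    proof (rule shift_limit[OF closed_value v lim_weights])
      show "0 \<le> c * dist (u n) (u (m + n))" for m using c by simp
      show "y \<in> f xbar + shift (c * dist (u n) (u (m + n)))" for m using weights that by blast
    qed
    then show ?thesis unfolding S_set_iff by blast
  qed
qed

text \<open>
  The weight is accumulated step by step instead of being taken from \<open>u n \<in> S(u 0)\<close>, which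
  would only see the distance from \<open>u 0\<close> to \<open>u n\<close> and not the length of the chain.
\<close>

lemma chain_weight:
  assumes c: "0 \<le> c" and chain: "\<And>n. u (Suc n) \<in> S_set K H f c (u n)"
  shows "f (u 0) \<subseteq> f (u n) + shift (c * (\<Sum>i<n. dist (u i) (u (Suc i))))"
proof (induction n)
  case 0
  show ?case using S_set_refl[of "u 0" f c] by (simp add: S_set_iff)
next
  case (Suc n)
  from shift_chain[OF Suc chain[unfolded S_set_iff]]
  show ?case using c by (simp add: sum_nonneg distrib_left)
qed

lemma weight_less_if_unreached:
  assumes "y0 \<in> f x0" "y0 \<notin> (\<Union>x\<in>T. f x) + shift eps"
    and "x \<in> T" "f x0 \<subseteq> f x + shift t"
  shows "t < eps"
proof (rule ccontr)
  assume "\<not> t < eps"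
  then have "f x + shift t \<subseteq> (\<Union>x\<in>T. f x) + shift eps"
    using assms(3) by (intro set_plus_mono2 shift_antimono) auto
  then show False using assms by blast
qed

end

lemma Cauchy_if_bounded_length:
  fixes u :: "nat \<Rightarrow> 'a::metric_space"
  assumes "\<And>n. (\<Sum>i<n. dist (u i) (u (Suc i))) \<le> B"
  shows "Cauchy u"
proof -
  let ?s = "\<lambda>n. \<Sum>i<n. dist (u i) (u (Suc i))"
  have "summable (\<lambda>i. dist (u i) (u (Suc i)))"
    by (rule bounded_imp_summable[where B = B])
      (use assms[of "Suc _"] in \<open>simp_all add: lessThan_Suc_atMost\<close>)
  then have "Cauchy ?s"
    using summable_iff_convergent convergent_Cauchy by blast
  have len: "dist (u m) (u n) \<le> dist (?s m) (?s n)" if "m \<le> n" for m n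
    using that
  proof (induction n rule: dec_induct)
    case base
    show ?case by simp
  next
    case (step n)
    have "?s m \<le> ?s n" using step.hyps by (intro sum_mono2) auto
    then show ?case
      using step.IH dist_triangle[of "u m" "u (Suc n)" "u n"] by (simp add: dist_real_def)
  qed
  have "dist (u m) (u n) \<le> dist (?s m) (?s n)" for m n
    using len[of m n] len[of n m] by (cases "m \<le> n") (auto simp: dist_commute)
  with \<open>Cauchy ?s\<close> show ?thesis unfolding Cauchy_def by (meson le_less_trans)
qed

section \<open>The variational principle\<close>

theorem corollary5p6:
  fixes K H :: "'b::real_vector set"
    and f :: "'a::metric_space \<Rightarrow> 'b set"
    and x0 :: 'a and v0 :: 'b and eps lam :: real
  assumes "nontrivial_convex_cone K"
    and "H \<noteq> {}" and "H \<subseteq> K" and "K_convex K H"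
    and "0 \<notin> vcl (H + K)"
    and "eps > 0" and "lam > 0"
    and "dynamically_complete (S_set K H f (eps / lam)) x0"
    and "\<not> f x0 \<subseteq> (\<Union>x\<in>S_set K H f (eps / lam) x0. f x) + (*\<^sub>R) eps ` H + K"
    and "K_slm K f"
    and "v0 \<in> K + H" and "KH_dir_closed_values K H v0 f"
  shows "\<exists>xbar.
      f x0 \<subseteq> f xbar + (*\<^sub>R) (eps / lam * dist x0 xbar) ` H + K
    \<and> (\<forall>x. x \<noteq> xbar \<longrightarrow> \<not> f xbar \<subseteq> f x + (*\<^sub>R) (eps / lam * dist xbar x) ` H + K)
    \<and> dist x0 xbar \<le> lam"
proof -
  interpret cone_perturbation K H
    using assms(1-4) by unfold_locales (auto simp: nontrivial_convex_cone_def K_convex_def)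
  let ?c = "eps / lam"
  let ?S = "S_set K H f ?c"
  have c: "0 < ?c" using assms(6,7) by simp
  have v0: "v0 \<in> H + K" using assms(11) by (simp add: add.commute)
  obtain y0 where y0: "y0 \<in> f x0" "y0 \<notin> (\<Union>x\<in>?S x0. f x) + shift eps"
    using assms(9) by (auto simp: add.assoc)
  have length_bound: "t < lam" if "x \<in> ?S x0" "f x0 \<subseteq> f x + shift (?c * t)" for x t
    using weight_less_if_unreached[OF y0 that] assms(6,7) by (simp add: field_simps)
  have near: "dist x0 x < lam" if "x \<in> ?S x0" for x
    using length_bound[OF that] that by (simp add: S_set_iff)
  have "\<exists>xbar\<in>?S x0. ?S xbar \<subseteq> {xbar}"
  proof (rule maximal_point_of_preorder)
    show "x \<in> ?S x" for x by (rule S_set_refl)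
    show "z \<in> ?S x" if "y \<in> ?S x" "z \<in> ?S y" for x y z
      using S_set_trans c that by (meson less_imp_le)
    show "bounded (?S x0)"
      using near less_imp_le unfolding bounded_def by blast
    fix u :: "nat \<Rightarrow> 'a" assume u0: "u 0 = x0" and chain: "\<And>n. u (Suc n) \<in> ?S (u n)"
    have in_S: "u n \<in> ?S x0" for n
      using S_set_chain_mono[of ?c u f 0 n] chain c u0 by simp
    have "(\<Sum>i<n. dist (u i) (u (Suc i))) \<le> lam" for n
      using length_bound[OF in_S[of n]] chain_weight[of ?c u f n] chain c u0
      by (simp add: less_imp_le)
    then have "Cauchy u" by (rule Cauchy_if_bounded_length)
    then obtain xbar where "u \<longlonglongrightarrow> xbar"
      using assms(8) in_S chain unfolding dynamically_complete_def by blast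
    then show "\<exists>xbar. u \<longlonglongrightarrow> xbar \<and> (\<forall>n. xbar \<in> ?S (u n))"
      using chain_limit_in_S_set[OF c assms(10,12) v0] chain by blast
  qed
  then obtain xbar where xbar: "xbar \<in> ?S x0" "?S xbar \<subseteq> {xbar}" by blast
  show ?thesis
  proof (intro exI conjI allI impI)
    show "f x0 \<subseteq> f xbar + (*\<^sub>R) (?c * dist x0 xbar) ` H + K"
      using xbar(1) by (simp add: S_set_def)
    show "\<not> f xbar \<subseteq> f x + (*\<^sub>R) (?c * dist xbar x) ` H + K" if "x \<noteq> xbar" for x
      using xbar(2) that by (auto simp: S_set_def)
    show "dist x0 xbar \<le> lam" using near[OF xbar(1)] by simp
  qed
qed

end
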